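(* For every pushdown automaton there is a guarded sequential recursive specification with signals and conditions with the same process.
   Context: A pushdown automaton $(\mathcal{S},\mathcal{A},\mathcal{D},\rightarrow,\uparrow,\downarrow)$ has finitely many states $\mathcal{S}$, input alphabet $\mathcal{A}$, data alphabet $\mathcal{D}$, finitely many transitions $s\xrightarrow{a[d/x]}t$ (with $d$ on top of the stack, replace it by string $x$) or $s\xrightarrow{a[\epsilon/x]}t$ (stack empty, push $x$), $a\in\mathcal{A}\cup\{\tau\}$, initial state $\uparrow$ and final states $\downarrow$. Its process graph has states $(s,x)$ with $x\in\mathcal{D}^*$, initial state $(\uparrow,\epsilon)$, accepting states $(s,x)$ with $s$ final (acceptance by final state). Specifications are finite guarded recursive specifications $X\stackrel{\mathrm{def}}{=}p$ over process expressions built from $\mathbf{0}$, $\mathbf{1}$, action prefix, choice, sequencing $p;q$ (in which $p;q$ can perform a step of $q$ only if $p$ accepts and has no outgoing step), guarded commands $\phi:\rightarrow p$ and root-signal emission $\mathrm{RSE}(\phi,p)$ (process $p$ emitting signal $\phi$ in its initial state), with propositions $\phi$ from a free Boolean algebra over propositional variables, and an effect function giving the valuation after each action. The process of a specification is its process graph where $p\xrightarrow{a}q$ iff for all valuations $v$ with $\mathit{Cons}(\langle p,v\rangle)$ we have $\langle p,v\rangle\xrightarrow{a}\langle q,\mathit{effect}(a,v)\rangle$, and $p$ accepts iff $\langle p,v\rangle$ accepts for all consistent $v$. "Same process" means bisimilar process graphs. *)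

theory Defs
  imports Main
begin

datatype 'a act = Tau | Act 'a

section \<open>Process graphs and bisimilarity\<close>

record ('n, 'a) process_graph =
  initial :: 'n
  gtrans :: "'n \<Rightarrow> 'a act \<Rightarrow> 'n \<Rightarrow> bool"
  accepting :: "'n \<Rightarrow> bool"

definition bisimulation ::
  "('m, 'a) process_graph \<Rightarrow> ('n, 'a) process_graph \<Rightarrow> ('m \<Rightarrow> 'n \<Rightarrow> bool) \<Rightarrow> bool"
where
  "bisimulation G H R \<longleftrightarrow>
     (\<forall>m n. R m n \<longrightarrow>
        (\<forall>a m'. gtrans G m a m' \<longrightarrow> (\<exists>n'. gtrans H n a n' \<and> R m' n')) \<and>
        (\<forall>a n'. gtrans H n a n' \<longrightarrow> (\<exists>m'. gtrans G m a m' \<and> R m' n')) \<and>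
        (accepting G m \<longleftrightarrow> accepting H n))"

definition bisimilar :: "('m, 'a) process_graph \<Rightarrow> ('n, 'a) process_graph \<Rightarrow> bool" where
  "bisimilar G H \<longleftrightarrow> (\<exists>R. bisimulation G H R \<and> R (initial G) (initial H))"

section \<open>Pushdown automata\<close>

text \<open>
  A transition \<^term>\<open>(s, a, Some d, x, t)\<close> replaces \<^term>\<open>d\<close> on top of the stack by the
  string \<^term>\<open>x\<close>; \<^term>\<open>(s, a, None, x, t)\<close> pushes \<^term>\<open>x\<close> on the empty stack.
  The head of the list is the top of the stack.
\<close>

record ('s, 'a, 'd) pda =
  pda_states :: "'s set"
  pda_input :: "'a set"
  pda_data :: "'d set"
  pda_trans :: "('s \<times> 'a act \<times> 'd option \<times> 'd list \<times> 's) set"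
  pda_initial :: 's
  pda_final :: "'s set"

definition pushdown_automaton :: "('s, 'a, 'd) pda \<Rightarrow> bool" where
  "pushdown_automaton M \<longleftrightarrow>
     finite (pda_states M) \<and>
     finite (pda_trans M) \<and>
     (\<forall>(s, a, e, x, t) \<in> pda_trans M.
        s \<in> pda_states M \<and> set_act a \<subseteq> pda_input M \<and> set_option e \<subseteq> pda_data M \<and>
        set x \<subseteq> pda_data M \<and> t \<in> pda_states M) \<and>
     pda_initial M \<in> pda_states M \<and>
     pda_final M \<subseteq> pda_states M"

inductive pda_step ::
  "('s, 'a, 'd) pda \<Rightarrow> 's \<times> 'd list \<Rightarrow> 'a act \<Rightarrow> 's \<times> 'd list \<Rightarrow> bool" for M
where
  "(s, a, Some d, x, t) \<in> pda_trans M \<Longrightarrow> pda_step M (s, d # y) a (t, x @ y)"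
| "(s, a, None, x, t) \<in> pda_trans M \<Longrightarrow> pda_step M (s, []) a (t, x)"

definition pda_graph :: "('s, 'a, 'd) pda \<Rightarrow> ('s \<times> 'd list, 'a) process_graph" where
  "pda_graph M =
     \<lparr>initial = (pda_initial M, []),
      gtrans = pda_step M,
      accepting = (\<lambda>(s, x). s \<in> pda_final M)\<rparr>"

section \<open>The free Boolean algebra over propositional variables\<close>

type_synonym 'p valuation = "'p \<Rightarrow> bool"

datatype 'p form = FVar 'p | FFalse | FNot "'p form" | FAnd "'p form" "'p form"

primrec form_holds :: "'p valuation \<Rightarrow> 'p form \<Rightarrow> bool" where
  "form_holds v (FVar P) = v P"
| "form_holds v FFalse = False"
| "form_holds v (FNot f) = (\<not> form_holds v f)"
| "form_holds v (FAnd f g) = (form_holds v f \<and> form_holds v g)"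

definition form_equiv :: "'p form \<Rightarrow> 'p form \<Rightarrow> bool" where
  "form_equiv f g \<longleftrightarrow> (\<forall>v. form_holds v f = form_holds v g)"

quotient_type 'p bprop = "'p form" / form_equiv
  by (intro equivpI reflpI sympI transpI) (auto simp: form_equiv_def)

lift_definition prop_var :: "'p \<Rightarrow> 'p bprop" is FVar .

lift_definition holds :: "'p valuation \<Rightarrow> 'p bprop \<Rightarrow> bool" is form_holds
  by (simp add: form_equiv_def)

lemma holds_prop_var [simp]: "holds v (prop_var P) = v P"
  by transfer simp

lemma bprop_eqI: "(\<And>v. holds v \<phi> = holds v \<psi>) \<Longrightarrow> \<phi> = \<psi>"
  by transfer (simp add: form_equiv_def)

instantiation bprop :: (type) boolean_algebra
begin

lift_definition bot_bprop :: "'a bprop" is FFalse .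

lift_definition top_bprop :: "'a bprop" is "FNot FFalse" .

lift_definition uminus_bprop :: "'a bprop \<Rightarrow> 'a bprop" is FNot
  by (simp add: form_equiv_def)

lift_definition inf_bprop :: "'a bprop \<Rightarrow> 'a bprop \<Rightarrow> 'a bprop" is FAnd
  by (simp add: form_equiv_def)

definition sup_bprop :: "'a bprop \<Rightarrow> 'a bprop \<Rightarrow> 'a bprop" where
  "sup_bprop \<phi> \<psi> = - inf (- \<phi>) (- \<psi>)"

definition minus_bprop :: "'a bprop \<Rightarrow> 'a bprop \<Rightarrow> 'a bprop" where
  "minus_bprop \<phi> \<psi> = inf \<phi> (- \<psi>)"

definition less_eq_bprop :: "'a bprop \<Rightarrow> 'a bprop \<Rightarrow> bool" where
  "less_eq_bprop \<phi> \<psi> \<longleftrightarrow> inf \<phi> \<psi> = \<phi>"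

definition less_bprop :: "'a bprop \<Rightarrow> 'a bprop \<Rightarrow> bool" where
  "less_bprop \<phi> \<psi> \<longleftrightarrow> inf \<phi> \<psi> = \<phi> \<and> inf \<psi> \<phi> \<noteq> \<psi>"

lemma holds_boolean_aux:
  "holds v (bot :: 'a bprop) = False"
  "holds v (top :: 'a bprop) = True"
  "holds v (- \<phi>) = (\<not> holds v \<phi>)"
  "holds v (inf \<phi> \<psi>) = (holds v \<phi> \<and> holds v \<psi>)"
  "holds v (sup \<phi> \<psi>) = (holds v \<phi> \<or> holds v \<psi>)"
  "holds v (\<phi> - \<psi>) = (holds v \<phi> \<and> \<not> holds v \<psi>)"
  unfolding sup_bprop_def minus_bprop_def by (transfer; simp)+

lemma bprop_eq_iff: "\<phi> = \<psi> \<longleftrightarrow> (\<forall>v. holds v \<phi> = holds v \<psi>)"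
  using bprop_eqI by blast

instance
  by standard
    (auto simp: less_eq_bprop_def less_bprop_def bprop_eq_iff holds_boolean_aux)

end

lemmas holds_boolean [simp] = holds_boolean_aux

section \<open>Sequential expressions with signals and conditions\<close>

text \<open>
  \<^term>\<open>Guard \<phi> p\<close> is the guarded command, \<^term>\<open>Emit \<phi> p\<close> the root-signal emission
  \<open>RSE(\<phi>, p)\<close>, and \<^term>\<open>Seq p q\<close> the sequencing \<open>p ; q\<close>.
\<close>

datatype (pexp_vars: 'x, pexp_acts: 'a, dead 'p) pexp =
    Zero
  | One
  | Var 'x
  | Prefix "'a act" "('x, 'a, 'p) pexp"
  | Choice "('x, 'a, 'p) pexp" "('x, 'a, 'p) pexp"
  | Seq "('x, 'a, 'p) pexp" "('x, 'a, 'p) pexp"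
  | Guard "'p bprop" "('x, 'a, 'p) pexp"
  | Emit "'p bprop" "('x, 'a, 'p) pexp"

record ('x, 'a, 'p) spec =
  defn :: "'x \<rightharpoonup> ('x, 'a, 'p) pexp"
  root :: 'x
  effect :: "'a act \<Rightarrow> 'p valuation \<Rightarrow> 'p valuation"

primrec guarded :: "('x, 'a, 'p) pexp \<Rightarrow> bool" where
  "guarded Zero = True"
| "guarded One = True"
| "guarded (Var X) = False"
| "guarded (Prefix a p) = True"
| "guarded (Choice p q) = (guarded p \<and> guarded q)"
| "guarded (Seq p q) = (guarded p \<and> guarded q)"
| "guarded (Guard \<phi> p) = guarded p"
| "guarded (Emit \<phi> p) = guarded p"

text \<open>
  Finite guarded recursive specifications with actions from \<^term>\<open>A\<close> and the silent action,
  which counts as a guard like any other action.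
\<close>

definition guarded_spec :: "'a set \<Rightarrow> ('x, 'a, 'p) spec \<Rightarrow> bool" where
  "guarded_spec A E \<longleftrightarrow>
     finite (dom (defn E)) \<and>
     root E \<in> dom (defn E) \<and>
     (\<forall>p \<in> ran (defn E). pexp_vars p \<subseteq> dom (defn E) \<and> pexp_acts p \<subseteq> A \<and> guarded p)"

section \<open>Operational semantics\<close>

text \<open>
  The configuration \<open>\<langle>p, v\<rangle>\<close> is given by the last two arguments. Acceptance and transitions are
  only consulted at consistent configurations, and the subexpressions of a consistent configuration
  that contribute to its behaviour are consistent themselves; hence the rules need no premises on
  the consistency of the source.
\<close>

inductive accepts :: "('x, 'a, 'p) spec \<Rightarrow> ('x, 'a, 'p) pexp \<Rightarrow> 'p valuation \<Rightarrow> bool" for E where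
  "accepts E One v"
| "accepts E p v \<Longrightarrow> defn E X = Some p \<Longrightarrow> accepts E (Var X) v"
| "accepts E p v \<Longrightarrow> accepts E (Choice p q) v"
| "accepts E q v \<Longrightarrow> accepts E (Choice p q) v"
| "accepts E p v \<Longrightarrow> accepts E q v \<Longrightarrow> accepts E (Seq p q) v"
| "accepts E p v \<Longrightarrow> holds v \<phi> \<Longrightarrow> accepts E (Guard \<phi> p) v"
| "accepts E p v \<Longrightarrow> holds v \<phi> \<Longrightarrow> accepts E (Emit \<phi> p) v"

text \<open>
  The signal in the initial state of \<^term>\<open>q\<close> is visible in \<^term>\<open>Seq p q\<close> exactly if
  \<^term>\<open>p\<close> accepts.
\<close>

inductive consistent :: "('x, 'a, 'p) spec \<Rightarrow> ('x, 'a, 'p) pexp \<Rightarrow> 'p valuation \<Rightarrow> bool" for E where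
  "consistent E Zero v"
| "consistent E One v"
| "consistent E p v \<Longrightarrow> defn E X = Some p \<Longrightarrow> consistent E (Var X) v"
| "consistent E (Prefix a p) v"
| "consistent E p v \<Longrightarrow> consistent E q v \<Longrightarrow> consistent E (Choice p q) v"
| "consistent E p v \<Longrightarrow> \<not> accepts E p v \<Longrightarrow> consistent E (Seq p q) v"
| "consistent E p v \<Longrightarrow> consistent E q v \<Longrightarrow> consistent E (Seq p q) v"
| "consistent E p v \<Longrightarrow> consistent E (Guard \<phi> p) v"
| "\<not> holds v \<phi> \<Longrightarrow> consistent E (Guard \<phi> p) v"
| "consistent E p v \<Longrightarrow> holds v \<phi> \<Longrightarrow> consistent E (Emit \<phi> p) v"

text \<open>
  The rule for sequencing has the negative premise that \<open>\<langle>p, v\<rangle>\<close> has no outgoing step, so the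
  transition relation is not an inductive predicate. Instead \<open>outs E p v T\<close> says that \<open>T\<close> is the
  set of all pairs \<open>(a, q)\<close> with \<open>\<langle>p, v\<rangle> \<rightarrow>\<^sup>a \<langle>q, effect(a, v)\<rangle>\<close>. For guarded specifications this
  set exists and is unique (\<open>outs_total\<close>, \<open>outs_unique\<close>), and the usual rules are the
  equivalences \<open>step_iffs\<close>. Steps lead to consistent configurations only.
\<close>

inductive outs ::
  "('x, 'a, 'p) spec \<Rightarrow> ('x, 'a, 'p) pexp \<Rightarrow> 'p valuation \<Rightarrow> ('a act \<times> ('x, 'a, 'p) pexp) set \<Rightarrow> bool"
  for E
where
  "outs E Zero v {}"
| "outs E One v {}"
| "outs E p v T \<Longrightarrow> defn E X = Some p \<Longrightarrow> outs E (Var X) v T"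
| "outs E (Prefix a p) v (if consistent E p (effect E a v) then {(a, p)} else {})"
| "outs E p v T \<Longrightarrow> outs E q v U \<Longrightarrow> outs E (Choice p q) v (T \<union> U)"
| "outs E p v T \<Longrightarrow> T \<noteq> {} \<or> \<not> accepts E p v \<Longrightarrow>
   outs E (Seq p q) v {(a, Seq p' q) | a p'. (a, p') \<in> T \<and> consistent E (Seq p' q) (effect E a v)}"
| "outs E p v {} \<Longrightarrow> accepts E p v \<Longrightarrow> outs E q v U \<Longrightarrow> outs E (Seq p q) v U"
| "outs E p v T \<Longrightarrow> outs E (Guard \<phi> p) v (if holds v \<phi> then T else {})"
| "outs E p v T \<Longrightarrow> outs E (Emit \<phi> p) v (if holds v \<phi> then T else {})"

definition step ::
  "('x, 'a, 'p) spec \<Rightarrow> ('x, 'a, 'p) pexp \<times> 'p valuation \<Rightarrow> 'a act \<Rightarrow>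
   ('x, 'a, 'p) pexp \<times> 'p valuation \<Rightarrow> bool"
where
  "step E = (\<lambda>(p, v) a (q, w). w = effect E a v \<and> (\<exists>T. outs E p v T \<and> (a, q) \<in> T))"

definition spec_graph :: "('x, 'a, 'p) spec \<Rightarrow> (('x, 'a, 'p) pexp, 'a) process_graph" where
  "spec_graph E =
     \<lparr>initial = Var (root E),
      gtrans = (\<lambda>p a q. \<forall>v. consistent E p v \<longrightarrow> step E (p, v) a (q, effect E a v)),
      accepting = (\<lambda>p. \<forall>v. consistent E p v \<longrightarrow> accepts E p v)\<rparr>"

section \<open>The transition relation of a guarded specification\<close>

inductive_cases outs_elims:
  "outs E Zero v T" "outs E One v T" "outs E (Var X) v T" "outs E (Prefix a p) v T"
  "outs E (Choice p q) v T" "outs E (Guard \<phi> p) v T" "outs E (Emit \<phi> p) v T"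

inductive_cases outs_SeqE: "outs E (Seq p q) v T"

lemma outs_SeqD:
  assumes "outs E (Seq p q) v T"
  obtains (first) U where "outs E p v U" "U \<noteq> {} \<or> \<not> accepts E p v"
      "T = {(a, Seq p' q) | a p'. (a, p') \<in> U \<and> consistent E (Seq p' q) (effect E a v)}"
    | (second) "outs E p v {}" "accepts E p v" "outs E q v T"
proof -
  from assms show thesis
  proof (rule outs_SeqE, goal_cases)
    case (1 U)
    then show ?case by (intro first[of U]) simp_all
  next
    case 2
    then show ?case by (intro second)
  qed
qed

lemma outs_unique: "outs E p v T \<Longrightarrow> outs E p v U \<Longrightarrow> T = U"
proof (induction arbitrary: U rule: outs.induct)
  case (3 p v T X)
  from 3(4) show ?case using 3(1-3) by (elim outs_elims(3)) simp
next
  case (5 p v T q T')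
  from 5(5) show ?case using 5(3,4) by (elim outs_elims(5)) blast
next
  case (6 p v T q)
  from 6(4) show ?case
  proof (cases rule: outs_SeqD)
    case (first T')
    with 6(3)[of T'] show ?thesis by simp
  next
    case second
    with 6(2) 6(3)[of "{}"] show ?thesis by simp
  qed
next
  case (7 p v q T)
  from 7(6) show ?case
  proof (cases rule: outs_SeqD)
    case (first T')
    with 7(2) 7(4)[of T'] show ?thesis by simp
  next
    case second
    with 7(5) show ?thesis by simp
  qed
next
  case (8 p v T \<phi>)
  from 8(3) show ?case using 8(2) by (elim outs_elims(6)) auto
next
  case (9 p v T \<phi>)
  from 9(3) show ?case using 9(2) by (elim outs_elims(7)) auto
qed (auto elim: outs_elims(1,2,4))

lemma outs_Seq_total: "outs E p v T \<Longrightarrow> outs E q v U \<Longrightarrow> \<exists>T. outs E (Seq p q) v T"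
  by (cases "T \<noteq> {} \<or> \<not> accepts E p v") (auto intro: outs.intros(6,7))

lemma outs_total_guarded: "guarded p \<Longrightarrow> \<exists>T. outs E p v T"
proof (induction p)
  case (Seq p q)
  then obtain T U where "outs E p v T" "outs E q v U" by auto
  then show ?case by (rule outs_Seq_total)
next
  case Zero
  show ?case by (rule exI, rule outs.intros(1))
next
  case One
  show ?case by (rule exI, rule outs.intros(2))
next
  case (Prefix a p)
  show ?case by (rule exI, rule outs.intros(4))
next
  case (Choice p q)
  then obtain T U where "outs E p v T" "outs E q v U" by auto
  then have "outs E (Choice p q) v (T \<union> U)" by (rule outs.intros(5))
  then show ?case ..
next
  case (Guard \<phi> p)
  then obtain T where "outs E p v T" by auto
  then have "outs E (Guard \<phi> p) v (if holds v \<phi> then T else {})" by (rule outs.intros(8))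
  then show ?case ..
next
  case (Emit \<phi> p)
  then obtain T where "outs E p v T" by auto
  then have "outs E (Emit \<phi> p) v (if holds v \<phi> then T else {})" by (rule outs.intros(9))
  then show ?case ..
qed simp

lemma outs_total:
  "guarded_spec A E \<Longrightarrow> pexp_vars p \<subseteq> dom (defn E) \<Longrightarrow> \<exists>T. outs E p v T"
proof (induction p)
  case (Var X)
  then obtain p where p: "defn E X = Some p" by auto
  with Var have "guarded p" by (auto simp: guarded_spec_def ran_def)
  with p show ?case using outs_total_guarded outs.intros(3) by metis
next
  case (Seq p q)
  then obtain T U where "outs E p v T" "outs E q v U" by auto
  then show ?case by (rule outs_Seq_total)
next
  case Zero
  show ?case by (rule exI, rule outs.intros(1))
next
  case One
  show ?case by (rule exI, rule outs.intros(2))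
next
  case (Prefix a p)
  show ?case by (rule exI, rule outs.intros(4))
next
  case (Choice p q)
  then obtain T U where "outs E p v T" "outs E q v U" by auto
  then have "outs E (Choice p q) v (T \<union> U)" by (rule outs.intros(5))
  then show ?case ..
next
  case (Guard \<phi> p)
  then obtain T where "outs E p v T" by auto
  then have "outs E (Guard \<phi> p) v (if holds v \<phi> then T else {})" by (rule outs.intros(8))
  then show ?case ..
next
  case (Emit \<phi> p)
  then obtain T where "outs E p v T" by auto
  then have "outs E (Emit \<phi> p) v (if holds v \<phi> then T else {})" by (rule outs.intros(9))
  then show ?case ..
qed

lemma step_outs:
  "outs E p v T \<Longrightarrow> step E (p, v) a (q, w) \<longleftrightarrow> w = effect E a v \<and> (a, q) \<in> T"
  by (simp add: step_def) (metis outs_unique)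

lemma step_iffs:
  assumes E: "guarded_spec A E"
  shows
    "\<not> step E (Zero, v) a (r, w)"
    "\<not> step E (One, v) a (r, w)"
    "defn E X = Some p \<Longrightarrow> step E (Var X, v) a (r, w) \<longleftrightarrow> step E (p, v) a (r, w)"
    "step E (Prefix b p, v) a (r, w) \<longleftrightarrow> a = b \<and> r = p \<and> w = effect E a v \<and> consistent E p w"
    "pexp_vars p \<subseteq> dom (defn E) \<Longrightarrow> pexp_vars q \<subseteq> dom (defn E) \<Longrightarrow>
     step E (Choice p q, v) a (r, w) \<longleftrightarrow> step E (p, v) a (r, w) \<or> step E (q, v) a (r, w)"
    "pexp_vars p \<subseteq> dom (defn E) \<Longrightarrow> pexp_vars q \<subseteq> dom (defn E) \<Longrightarrow>
     step E (Seq p q, v) a (r, w) \<longleftrightarrow>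
       (\<exists>p'. step E (p, v) a (p', w) \<and> r = Seq p' q \<and> consistent E r w) \<or>
       (accepts E p v \<and> (\<forall>b p' u. \<not> step E (p, v) b (p', u)) \<and> step E (q, v) a (r, w))"
    "pexp_vars p \<subseteq> dom (defn E) \<Longrightarrow>
     step E (Guard \<phi> p, v) a (r, w) \<longleftrightarrow> holds v \<phi> \<and> step E (p, v) a (r, w)"
    "pexp_vars p \<subseteq> dom (defn E) \<Longrightarrow>
     step E (Emit \<phi> p, v) a (r, w) \<longleftrightarrow> holds v \<phi> \<and> step E (p, v) a (r, w)"
proof -
  show "\<not> step E (Zero, v) a (r, w)" "\<not> step E (One, v) a (r, w)"
    by (simp_all add: step_outs[OF outs.intros(1)] step_outs[OF outs.intros(2)])
  show "step E (Prefix b p, v) a (r, w) \<longleftrightarrow> a = b \<and> r = p \<and> w = effect E a v \<and> consistent E p w"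
    by (auto simp: step_outs[OF outs.intros(4)])
  assume X: "defn E X = Some p"
  have "outs E (Var X) v T \<longleftrightarrow> outs E p v T" for T
    using X by (auto intro: outs.intros(3)[of E p v T X] elim: outs_elims(3)[of E X v T])
  then show "step E (Var X, v) a (r, w) \<longleftrightarrow> step E (p, v) a (r, w)"
    by (simp add: step_def)
next
  assume p: "pexp_vars p \<subseteq> dom (defn E)"
  then obtain T where T: "outs E p v T" using outs_total[OF E] by blast
  show "step E (Guard \<phi> p, v) a (r, w) \<longleftrightarrow> holds v \<phi> \<and> step E (p, v) a (r, w)"
    "step E (Emit \<phi> p, v) a (r, w) \<longleftrightarrow> holds v \<phi> \<and> step E (p, v) a (r, w)"
    by (auto simp: step_outs[OF T] step_outs[OF outs.intros(8)[OF T]]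
        step_outs[OF outs.intros(9)[OF T]])
  assume q: "pexp_vars q \<subseteq> dom (defn E)"
  then obtain U where U: "outs E q v U" using outs_total[OF E] by blast
  show "step E (Choice p q, v) a (r, w) \<longleftrightarrow> step E (p, v) a (r, w) \<or> step E (q, v) a (r, w)"
    by (auto simp: step_outs[OF T] step_outs[OF U] step_outs[OF outs.intros(5)[OF T U]])
  show "step E (Seq p q, v) a (r, w) \<longleftrightarrow>
       (\<exists>p'. step E (p, v) a (p', w) \<and> r = Seq p' q \<and> consistent E r w) \<or>
       (accepts E p v \<and> (\<forall>b p' u. \<not> step E (p, v) b (p', u)) \<and> step E (q, v) a (r, w))"
  proof (cases "T \<noteq> {} \<or> \<not> accepts E p v")
    case True
    then show ?thesis
      by (auto simp: step_outs[OF T] step_outs[OF outs.intros(6)[OF T True]])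
  next
    case False
    with T have "outs E p v {}" "accepts E p v" by auto
    note S = step_outs[OF outs.intros(7)[OF this U]]
    from False show ?thesis by (auto simp: S step_outs[OF T] step_outs[OF U])
  qed
qed

end

theory Submission
  imports Defs
begin

text \<open>
  The expression for a configuration of the automaton signals its control state, followed by a
  sequencing of one variable per stack symbol, the last one standing for the bottom of the stack.
  An action makes all propositional variables true, so every signal is possible after every
  action. A step of the process graph must however exist under all consistent valuations,
  in particular under the valuation in which only the signalled state is true; hence only the
  transitions of the signalled state count.

  A stack symbol must accept in a final state even if it has no transition there, without the
  symbol below it getting to move. Therefore every variable also has a silent step whose target
  depends on a propositional variable that is never signalled: under each valuation the variable
  can move, so sequencing never skips it, but no such step is present under all valuations.
\<close>

lemma pda_step_Nil: "pda_step M (s, []) a (t, y) \<longleftrightarrow> (s, a, None, y, t) \<in> pda_trans M"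
  by (simp add: pda_step.simps)

lemma pda_step_Cons:
  "pda_step M (s, d # w) a (t, y) \<longleftrightarrow> (\<exists>x. (s, a, Some d, x, t) \<in> pda_trans M \<and> y = x @ w)"
  by (auto simp: pda_step.simps)

section \<open>Finite choices and inversion of the semantic rules\<close>

definition sum_exp :: "('x, 'a, 'p) pexp list \<Rightarrow> ('x, 'a, 'p) pexp" where
  "sum_exp ps = foldr Choice ps Zero"

lemma outs_sum_exp:
  assumes "\<And>i. i \<in> set is \<Longrightarrow> outs E (h i) v (F i)"
  shows "outs E (sum_exp (map h is)) v (\<Union>i\<in>set is. F i)"
  using assms
proof (induction "is")
  case Nil
  then show ?case by (simp add: sum_exp_def outs.intros)
next
  case (Cons i "is")
  then show ?case
    using outs.intros(5)[of E "h i" v "F i" "sum_exp (map h is)"] by (simp add: sum_exp_def)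
qed

inductive_cases accepts_elims:
  "accepts E Zero v" "accepts E One v" "accepts E (Var X) v" "accepts E (Prefix a p) v"
  "accepts E (Choice p q) v" "accepts E (Seq p q) v" "accepts E (Guard \<phi> p) v"
  "accepts E (Emit \<phi> p) v"

inductive_cases consistent_elims:
  "consistent E (Var X) v" "consistent E (Seq p q) v" "consistent E (Emit \<phi> p) v"

lemma accepts_iffs:
  "\<not> accepts E Zero v"
  "accepts E One v"
  "accepts E (Var X) v \<longleftrightarrow> (\<exists>p. defn E X = Some p \<and> accepts E p v)"
  "\<not> accepts E (Prefix a p) v"
  "accepts E (Choice p q) v \<longleftrightarrow> accepts E p v \<or> accepts E q v"
  "accepts E (Seq p q) v \<longleftrightarrow> accepts E p v \<and> accepts E q v"
  "accepts E (Guard \<phi> p) v \<longleftrightarrow> holds v \<phi> \<and> accepts E p v"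
  "accepts E (Emit \<phi> p) v \<longleftrightarrow> holds v \<phi> \<and> accepts E p v"
  by (auto intro: accepts.intros elim: accepts_elims)

lemma accepts_sum_exp: "accepts E (sum_exp ps) v \<longleftrightarrow> (\<exists>p\<in>set ps. accepts E p v)"
  by (induction ps) (auto simp: sum_exp_def accepts_iffs)

lemma consistent_sum_exp: "(\<And>p. p \<in> set ps \<Longrightarrow> consistent E p v) \<Longrightarrow> consistent E (sum_exp ps) v"
  by (induction ps) (auto simp: sum_exp_def intro: consistent.intros)

lemma outs_Var_iff: "defn E X = Some p \<Longrightarrow> outs E (Var X) v T \<longleftrightarrow> outs E p v T"
  by (auto intro: outs.intros(3) elim: outs_elims(3))

lemma outs_Emit_iff: "holds v \<phi> \<Longrightarrow> outs E (Emit \<phi> p) v T \<longleftrightarrow> outs E p v T"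
  using outs.intros(9)[of E p v T \<phi>] by (auto elim: outs_elims(7))

text \<open>Targets are created only by the rules for prefix and for a moving first component of a
  sequence, and both check consistency; all other rules pass steps on unchanged.\<close>

lemma outs_consistent: "outs E p v T \<Longrightarrow> (a, q) \<in> T \<Longrightarrow> consistent E q (effect E a v)"
  by (induction rule: outs.induct) (auto split: if_splits)

lemma guarded_sum_exp: "guarded (sum_exp ps) \<longleftrightarrow> (\<forall>p\<in>set ps. guarded p)"
  by (induction ps) (auto simp: sum_exp_def)

lemma pexp_vars_sum_exp: "pexp_vars (sum_exp ps) = (\<Union>p\<in>set ps. pexp_vars p)"
  by (induction ps) (auto simp: sum_exp_def)

lemma pexp_acts_sum_exp: "pexp_acts (sum_exp ps) = (\<Union>p\<in>set ps. pexp_acts p)"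
  by (induction ps) (auto simp: sum_exp_def)

section \<open>Encoding an automaton as a specification\<close>

text \<open>
  The stack symbol \<^term>\<open>None\<close> marks the bottom of the stack. The lists \<open>trs\<close> and \<open>fins\<close> enumerate
  the transitions and the final states, and \<open>f\<close> and \<open>g\<close> number the states and the stack symbols.
\<close>

locale pda_encoding =
  fixes M :: "('s, 'a, 'd) pda"
    and trs :: "('s \<times> 'a act \<times> 'd option \<times> 'd list \<times> 's) list"
    and fins :: "'s list"
    and syms :: "'d option set"
    and f :: "'s \<Rightarrow> nat"
    and g :: "'d option \<Rightarrow> nat"
  assumes M: "pushdown_automaton M"
    and trs: "set trs = pda_trans M"
    and fins: "set fins = pda_final M"
    and finite_syms: "finite syms"
    and None_in_syms: "None \<in> syms"
    and trans_syms: "(s, a, e, x, t) \<in> pda_trans M \<Longrightarrow> e \<in> syms \<and> Some ` set x \<subseteq> syms"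
    and inj_f: "inj_on f (pda_states M)"
    and inj_g: "inj_on g syms"
begin

text \<open>The successor reserves \<open>0\<close>: as a propositional variable it drives the
  silent steps of \<open>dummy\<close>, and in \<open>sym_var\<close> it is kept free for the
  root.\<close>

definition state_var :: "'s \<Rightarrow> nat" where
  "state_var s = Suc (f s)"

definition sym_var :: "'d option \<Rightarrow> nat" where
  "sym_var e = Suc (g e)"

definition signal :: "'s \<Rightarrow> nat bprop" where
  "signal s = prop_var (state_var s)"

text \<open>A transition on the empty stack consumes the bottom marker \<open>None\<close>, so the
  marker is put back below the pushed string.\<close>

definition pushed :: "'d option \<Rightarrow> 'd list \<Rightarrow> 'd option list" where
  "pushed e x = map Some x @ (if e = None then [None] else [])"

definition stack_exp :: "'d option list \<Rightarrow> (nat, 'a, nat) pexp" where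
  "stack_exp z = foldr (\<lambda>e. Seq (Var (sym_var e))) z One"

definition branch :: "'s \<times> 'a act \<times> 'd option \<times> 'd list \<times> 's \<Rightarrow> (nat, 'a, nat) pexp" where
  "branch = (\<lambda>(s, a, e, x, t).
     Guard (signal s) (Prefix a (Emit (signal t) (stack_exp (pushed e x)))))"

definition dummy :: "(nat, 'a, nat) pexp" where
  "dummy = Choice (Guard (prop_var 0) (Prefix Tau Zero))
     (Guard (- prop_var 0) (Prefix Tau (Prefix Tau Zero)))"

definition sym_body :: "'d option \<Rightarrow> (nat, 'a, nat) pexp" where
  "sym_body e = Choice dummy
     (Choice (sum_exp (map branch (filter (\<lambda>(s, a, e', x, t). e' = e) trs)))
       (sum_exp (map (\<lambda>s. Guard (signal s) One) fins)))"

text \<open>The initial expression follows no action that could have emitted a state signal, so it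
  emits its own before acting as an empty stack.\<close>

definition root_body :: "(nat, 'a, nat) pexp" where
  "root_body = Emit (signal (pda_initial M)) (sym_body None)"

definition encoding :: "(nat, 'a, nat) spec" where
  "encoding =
     \<lparr>defn = (\<lambda>n. if n = 0 then Some root_body
        else if n \<in> sym_var ` syms then Some (sym_body (inv_into syms sym_var n)) else None),
      root = 0,
      effect = (\<lambda>_ _ _. True)\<rparr>"

section \<open>Guardedness of the encoding\<close>

lemma effect_encoding [simp]: "effect encoding a v = (\<lambda>_. True)"
  by (simp add: encoding_def)

lemma holds_signal [simp]: "holds v (signal s) \<longleftrightarrow> v (state_var s)"
  by (simp add: signal_def)

lemma pda_transD:
  assumes "(s, a, e, x, t) \<in> pda_trans M"
  shows "s \<in> pda_states M" "set_act a \<subseteq> pda_input M" "t \<in> pda_states M"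
  using M assms by (fastforce simp: pushdown_automaton_def)+

lemma state_var_eq_iff:
  "s \<in> pda_states M \<Longrightarrow> t \<in> pda_states M \<Longrightarrow> state_var s = state_var t \<longleftrightarrow> s = t"
  using inj_f by (auto simp: state_var_def inj_on_def)

lemma defn_sym_var: "e \<in> syms \<Longrightarrow> defn encoding (sym_var e) = Some (sym_body e)"
proof -
  assume e: "e \<in> syms"
  have "inj_on sym_var syms"
    using inj_g by (auto simp: sym_var_def inj_on_def)
  with e have "inv_into syms sym_var (sym_var e) = e" by simp
  with e show ?thesis by (simp add: encoding_def) (simp add: sym_var_def)
qed

lemma defn_root: "defn encoding 0 = Some root_body"
  by (simp add: encoding_def)

lemma dom_encoding: "dom (defn encoding) = insert 0 (sym_var ` syms)"
  by (auto simp: encoding_def dom_def split: if_splits)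

lemma set_pushed: "(s, a, e, x, t) \<in> pda_trans M \<Longrightarrow> set (pushed e x) \<subseteq> syms"
  using trans_syms[of s a e x t] None_in_syms by (auto simp: pushed_def)

lemma stack_exp_vars: "pexp_vars (stack_exp z) = sym_var ` set z"
  by (induction z) (auto simp: stack_exp_def)

lemma stack_exp_acts: "pexp_acts (stack_exp z) = {}"
  by (induction z) (auto simp: stack_exp_def)

lemma branch_exp:
  assumes "r \<in> pda_trans M"
  shows "guarded (branch r)" "pexp_vars (branch r) \<subseteq> sym_var ` syms"
    "pexp_acts (branch r) \<subseteq> pda_input M"
proof -
  obtain s a e x t where r: "r = (s, a, e, x, t)" by (cases r)
  show "guarded (branch r)" "pexp_vars (branch r) \<subseteq> sym_var ` syms"
    "pexp_acts (branch r) \<subseteq> pda_input M"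
    using assms set_pushed[of s a e x t] pda_transD[of s a e x t]
    by (auto simp: r branch_def stack_exp_vars stack_exp_acts)
qed

text \<open>Recursion variables occur only below the prefixes of \<open>branch\<close>, and these
  are variables of stack symbols, never the root.\<close>

lemma sym_body_exp:
  "guarded (sym_body e) \<and> pexp_vars (sym_body e) \<subseteq> sym_var ` syms \<and>
   pexp_acts (sym_body e) \<subseteq> pda_input M"
  using branch_exp trs
  by (fastforce simp: sym_body_def dummy_def guarded_sum_exp pexp_vars_sum_exp pexp_acts_sum_exp)

lemma guarded_encoding: "guarded_spec (pda_input M) encoding"
proof -
  have "pexp_vars p \<subseteq> insert 0 (sym_var ` syms) \<and> pexp_acts p \<subseteq> pda_input M \<and> guarded p"
    if "p \<in> ran (defn encoding)" for p
    using that sym_body_exp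
    by (fastforce simp: ran_def encoding_def root_body_def split: if_splits)
  then show ?thesis
    unfolding guarded_spec_def dom_encoding using finite_syms by (auto simp: encoding_def)
qed

section \<open>Behaviour of a single stack symbol\<close>

lemma consistent_sym_body: "consistent encoding (sym_body e) v"
  by (auto simp: sym_body_def dummy_def branch_def
      intro!: consistent.intros(2,4,5,8) consistent_sum_exp)

lemma accepts_sym_body:
  "accepts encoding (sym_body e) v \<longleftrightarrow> (\<exists>s\<in>pda_final M. v (state_var s))"
  by (auto simp: sym_body_def dummy_def branch_def accepts_iffs accepts_sum_exp fins)

lemma consistent_Var: "e \<in> syms \<Longrightarrow> consistent encoding (Var (sym_var e)) v"
  by (rule consistent.intros(3)[OF consistent_sym_body defn_sym_var])

lemma consistent_stack_exp: "set z \<subseteq> syms \<Longrightarrow> consistent encoding (stack_exp z) v"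
  by (induction z) (auto simp: stack_exp_def intro: consistent.intros consistent_Var)

definition sym_outs :: "'d option \<Rightarrow> nat valuation \<Rightarrow> ('a act \<times> (nat, 'a, nat) pexp) set" where
  "sym_outs e v = insert (Tau, if v 0 then Zero else Prefix Tau Zero)
     {(a, Emit (signal t) (stack_exp (pushed e x))) | s a x t.
        (s, a, e, x, t) \<in> pda_trans M \<and> v (state_var s)}"

text \<open>Every prefix target is consistent under the all-true valuation reached by an action, so
  no step is dropped. The summands for final states contribute acceptance only.\<close>

lemma outs_sym_body: "outs encoding (sym_body e) v (sym_outs e v)"
proof -
  let ?is = "filter (\<lambda>(s, a, e', x, t). e' = e) trs"
  define F where "F = (\<lambda>(s, a :: 'a act, e, x, t).
    if v (state_var s) then {(a, Emit (signal t) (stack_exp (pushed e x)))} else {})"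
  have branch: "outs encoding (branch i) v (F i)" if "i \<in> set ?is" for i
  proof -
    obtain s a e' x t where i: "i = (s, a, e', x, t)" by (cases i)
    have "(s, a, e', x, t) \<in> pda_trans M" using that trs unfolding i by auto
    then have "set (pushed e' x) \<subseteq> syms" by (rule set_pushed)
    then have "consistent encoding (Emit (signal t) (stack_exp (pushed e' x))) (\<lambda>_. True)"
      by (simp add: consistent.intros consistent_stack_exp)
    then show ?thesis
      using outs.intros(8)[OF outs.intros(4)[of encoding a
          "Emit (signal t) (stack_exp (pushed e' x))" v], of "signal s"]
      by (simp add: i branch_def F_def cong: if_cong)
  qed
  have final: "outs encoding (Guard (signal s) One) v {}" for s
    using outs.intros(8)[OF outs.intros(2)[of encoding v], of "signal s"] by simp
  have dummy: "outs encoding dummy v {(Tau, if v 0 then Zero else Prefix Tau Zero)}"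
    using outs.intros(5)[OF
        outs.intros(8)[OF outs.intros(4)[of encoding Tau Zero v], of "prop_var 0"]
        outs.intros(8)[OF outs.intros(4)[of encoding Tau "Prefix Tau Zero" v], of "- prop_var 0"]]
    by (cases "v 0") (simp_all add: dummy_def consistent.intros)
  have "outs encoding (sym_body e) v ({(Tau, if v 0 then Zero else Prefix Tau Zero)} \<union>
      ((\<Union>i\<in>set ?is. F i) \<union> (\<Union>s\<in>set fins. {})))"
    unfolding sym_body_def
    by (intro outs.intros(5) dummy outs_sum_exp branch final)
  also have "{(Tau, if v 0 then Zero else Prefix Tau Zero)} \<union>
      ((\<Union>i\<in>set ?is. F i) \<union> (\<Union>s\<in>set fins. {})) = sym_outs e v"
    by (force simp: F_def sym_outs_def trs split: if_splits)
  finally show ?thesis .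
qed

section \<open>Expressions representing configurations\<close>

inductive rep_stack :: "(nat, 'a, nat) pexp \<Rightarrow> 'd option list \<Rightarrow> bool" where
  "rep_stack One []"
| "e \<in> syms \<Longrightarrow> rep_stack (Var (sym_var e)) [e]"
| "rep_stack p y \<Longrightarrow> rep_stack q z \<Longrightarrow> rep_stack (Seq p q) (y @ z)"

text \<open>Steps inside the first component nest sequencing to the left and leave copies of
  \<open>One\<close> behind. Hence a stack is represented by any bracketing with any number of
  units; a configuration moreover has its signal at the leftmost leaf.\<close>

inductive rep_config :: "'s \<Rightarrow> (nat, 'a, nat) pexp \<Rightarrow> 'd option list \<Rightarrow> bool" where
  "rep_config (pda_initial M) (Var 0) [None]"
| "s \<in> pda_states M \<Longrightarrow> rep_stack p z \<Longrightarrow> rep_config s (Emit (signal s) p) z"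
| "rep_config s p y \<Longrightarrow> rep_stack q z \<Longrightarrow> rep_config s (Seq p q) (y @ z)"

lemma rep_config_state: "rep_config s p z \<Longrightarrow> s \<in> pda_states M"
  by (induction rule: rep_config.induct) (use M in \<open>simp_all add: pushdown_automaton_def\<close>)

lemma rep_stack_exp: "set z \<subseteq> syms \<Longrightarrow> rep_stack (stack_exp z) z"
proof (induction z)
  case Nil
  then show ?case by (simp add: stack_exp_def rep_stack.intros)
next
  case (Cons e z)
  then show ?case
    using rep_stack.intros(3)[OF rep_stack.intros(2)[of e], of "stack_exp z" z]
    by (simp add: stack_exp_def)
qed

lemma rep_stack_consistent: "rep_stack p z \<Longrightarrow> consistent encoding p v"
  by (induction rule: rep_stack.induct) (auto intro: consistent.intros consistent_Var)

text \<open>All stack symbols accept under the same condition, so a sequence of them accepts exactly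
  when one does; without symbols only units remain.\<close>

lemma rep_stack_accepts:
  "rep_stack p z \<Longrightarrow>
   accepts encoding p v \<longleftrightarrow> z = [] \<or> (\<exists>s\<in>pda_final M. v (state_var s))"
  by (induction rule: rep_stack.induct) (auto simp: accepts_iffs defn_sym_var accepts_sym_body)

text \<open>Stack expressions are consistent under every valuation, which leaves the signal at the
  left end as the only constraint.\<close>

lemma rep_config_consistent:
  "rep_config s p z \<Longrightarrow> consistent encoding p v \<longleftrightarrow> v (state_var s)"
proof (induction rule: rep_config.induct)
  case 1
  show ?case
    using consistent.intros(3)[OF _ defn_root] consistent.intros(10)[OF consistent_sym_body[of None v]]
    by (auto simp: defn_root root_body_def elim!: consistent_elims)
next
  case (2 s p z)
  then show ?case
    using rep_stack_consistent[of p z v] by (auto intro: consistent.intros elim: consistent_elims)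
next
  case (3 s p y q z)
  then show ?case
    using rep_stack_consistent[of q z v] by (auto intro: consistent.intros elim: consistent_elims)
qed

lemma rep_config_accepts:
  "rep_config s p z \<Longrightarrow> v (state_var s) \<Longrightarrow>
   accepts encoding p v \<longleftrightarrow> z = [] \<or> (\<exists>s\<in>pda_final M. v (state_var s))"
  by (induction rule: rep_config.induct)
    (auto simp: accepts_iffs defn_root root_body_def accepts_sym_body rep_stack_accepts)

section \<open>Steps common to all valuations of a signal\<close>

definition usteps :: "'s \<Rightarrow> (nat, 'a, nat) pexp \<Rightarrow> 'a act \<Rightarrow> (nat, 'a, nat) pexp \<Rightarrow> bool" where
  "usteps s p a q \<longleftrightarrow> (\<forall>v. v (state_var s) \<longrightarrow> (\<exists>T. outs encoding p v T \<and> (a, q) \<in> T))"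

text \<open>This is the invariant that survives sequencing. An empty stack must be stuck under each
  signalled valuation, so that control passes to the next component. A nonempty one must be able to
  move under each of them, so that it is never skipped, while only its uniform steps have to match
  transitions.\<close>

fun simulates :: "'s \<Rightarrow> (nat, 'a, nat) pexp \<Rightarrow> 'd option list \<Rightarrow> bool" where
  "simulates s p [] \<longleftrightarrow> (\<forall>v. v (state_var s) \<longrightarrow> outs encoding p v {})"
| "simulates s p (e # y) \<longleftrightarrow>
     (\<forall>v. v (state_var s) \<longrightarrow> (\<exists>T. outs encoding p v T \<and> T \<noteq> {})) \<and>
     (\<forall>a x t. (s, a, e, x, t) \<in> pda_trans M \<longrightarrow>
        (\<exists>q. usteps s p a q \<and> rep_config t q (pushed e x @ y))) \<and>
     (\<forall>a q. usteps s p a q \<longrightarrow>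
        (\<exists>x t. (s, a, e, x, t) \<in> pda_trans M \<and> rep_config t q (pushed e x @ y)))"

lemma simulates_trans:
  "simulates s p (e # y) \<Longrightarrow> (s, a, e, x, t) \<in> pda_trans M \<Longrightarrow>
   \<exists>q. usteps s p a q \<and> rep_config t q (pushed e x @ y)"
  by simp

lemma simulates_usteps:
  "simulates s p (e # y) \<Longrightarrow> usteps s p a q \<Longrightarrow>
   \<exists>x t. (s, a, e, x, t) \<in> pda_trans M \<and> rep_config t q (pushed e x @ y)"
  by simp

text \<open>Serves to unfold variables, to drop a satisfied signal and to skip a first component
  without stack symbols.\<close>

lemma simulates_cong:
  assumes "\<And>v T. v (state_var s) \<Longrightarrow> outs encoding p v T \<longleftrightarrow> outs encoding q v T"
  shows "simulates s p z \<longleftrightarrow> simulates s q z"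
proof -
  have "usteps s p = usteps s q"
    using assms by (simp add: usteps_def fun_eq_iff)
  then show ?thesis using assms by (cases z) simp_all
qed

lemma simulates_sym_body:
  assumes s: "s \<in> pda_states M"
  shows "simulates s (sym_body e) [e]"
proof -
  have usteps: "usteps s (sym_body e) a q \<longleftrightarrow> (\<forall>v. v (state_var s) \<longrightarrow> (a, q) \<in> sym_outs e v)" for a q
    unfolding usteps_def using outs_sym_body outs_unique by metis
  have target: "rep_config t (Emit (signal t) (stack_exp (pushed e x))) (pushed e x)"
    if "(s, a, e, x, t) \<in> pda_trans M" for a x t
    using that by (intro rep_config.intros(2) rep_stack_exp set_pushed pda_transD(3))
  have "\<exists>x t. (s, a, e, x, t) \<in> pda_trans M \<and> q = Emit (signal t) (stack_exp (pushed e x))"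
    if "usteps s (sym_body e) a q" for a q
  proof -
    \<comment> \<open>Both valuations make the signal of \<open>s\<close> and of no other state
      true, since \<open>state_var\<close> is never \<open>0\<close>. They differ at
      \<open>0\<close>, which gives the silent step different targets and so excludes it.\<close>
    have 1: "(a, q) \<in> sym_outs e (\<lambda>n. n = state_var s)"
      and 2: "(a, q) \<in> sym_outs e (\<lambda>n. n = state_var s \<or> n = 0)"
      using that by (simp_all add: usteps)
    from 2 have "q \<noteq> Prefix Tau Zero"
      by (auto simp: sym_outs_def)
    with 1 obtain s' x t where "(s', a, e, x, t) \<in> pda_trans M" "state_var s' = state_var s"
        "q = Emit (signal t) (stack_exp (pushed e x))"
      by (auto simp: sym_outs_def state_var_def)
    moreover from this have "s' = s" using s pda_transD(1) state_var_eq_iff by blast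
    ultimately show ?thesis by blast
  qed
  moreover have "usteps s (sym_body e) a (Emit (signal t) (stack_exp (pushed e x)))"
    if "(s, a, e, x, t) \<in> pda_trans M" for a x t
    using that by (auto simp: usteps sym_outs_def)
  moreover have "\<exists>T. outs encoding (sym_body e) v T \<and> T \<noteq> {}" for v
    using outs_sym_body[of e v] by (auto simp: sym_outs_def)
  ultimately show ?thesis using target unfolding simulates.simps append_Nil2 by blast
qed

text \<open>If \<open>y\<close> is empty, then \<open>p\<close> accepts without a step and the
  sequence moves exactly as \<open>q\<close>. Otherwise \<open>p\<close> can always move, so
  \<open>q\<close> stays untouched and is appended to each target.\<close>

lemma simulates_Seq:
  assumes p: "simulates s p y" and q: "simulates s q z" and rep: "rep_stack q z"
    and acc: "\<And>v. y = [] \<Longrightarrow> v (state_var s) \<Longrightarrow> accepts encoding p v"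
  shows "simulates s (Seq p q) (y @ z)"
proof (cases y)
  case Nil
  have "outs encoding (Seq p q) v T \<longleftrightarrow> outs encoding q v T" if v: "v (state_var s)" for v T
  proof -
    have p_outs: "outs encoding p v {}" and p_acc: "accepts encoding p v"
      using p acc v Nil by simp_all
    show ?thesis
    proof
      assume "outs encoding (Seq p q) v T"
      then show "outs encoding q v T"
        by (cases rule: outs_SeqD) (use outs_unique[OF p_outs] p_acc in auto)
    qed (rule outs.intros(7)[OF p_outs p_acc])
  qed
  then have "simulates s (Seq p q) z \<longleftrightarrow> simulates s q z" by (rule simulates_cong)
  then show ?thesis using q Nil by simp
next
  case (Cons e y')
  \<comment> \<open>The step set of the sequence while \<open>p\<close> moves. It depends on the
    valuation only through \<open>T\<close>, because every action leads to the all-true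
    valuation.\<close>
  define lift where
    "lift T = {(a, Seq p' q) | a p'. (a, p') \<in> T \<and> consistent encoding (Seq p' q) (\<lambda>_. True)}"
    for T :: "('a act \<times> (nat, 'a, nat) pexp) set"
  have lift: "outs encoding (Seq p q) v (lift T)" if "outs encoding p v T" "T \<noteq> {}" for v T
    using outs.intros(6)[OF that(1), of q] that(2) by (simp add: lift_def)
  have ne: "\<exists>T. outs encoding p v T \<and> T \<noteq> {}" if "v (state_var s)" for v
    using p Cons that by simp
  have fwd: "usteps s (Seq p q) a (Seq p' q)"
    if "usteps s p a p'" "rep_config t p' u" for a p' t u
    unfolding usteps_def
  proof (intro allI impI)
    fix v :: "nat valuation"
    assume "v (state_var s)"
    with that(1) obtain T where T: "outs encoding p v T" "(a, p') \<in> T"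
      by (auto simp: usteps_def)
    have "consistent encoding (Seq p' q) (\<lambda>_. True)"
      using rep_config_consistent[OF rep_config.intros(3)[OF that(2) rep]] by simp
    with T(2) have "(a, Seq p' q) \<in> lift T" by (simp add: lift_def)
    with lift[OF T(1)] T(2) show "\<exists>T. outs encoding (Seq p q) v T \<and> (a, Seq p' q) \<in> T"
      by blast
  qed
  have bwd: "\<exists>p'. r = Seq p' q \<and> usteps s p a p'" if "usteps s (Seq p q) a r" for a r
  proof -
    have *: "\<exists>p' T. r = Seq p' q \<and> outs encoding p v T \<and> (a, p') \<in> T" if v: "v (state_var s)" for v
    proof -
      obtain T where T: "outs encoding p v T" "T \<noteq> {}" using ne v by blast
      have "(a, r) \<in> lift T"
        using \<open>usteps s (Seq p q) a r\<close> v outs_unique[OF lift[OF T]] by (auto simp: usteps_def)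
      with T show ?thesis by (auto simp: lift_def)
    qed
    \<comment> \<open>The all-true valuation satisfies the signal and fixes \<open>p'\<close>; by
      injectivity of \<open>Seq\<close> every other valuation yields the same
      \<open>p'\<close>.\<close>
    obtain p' where r: "r = Seq p' q" using *[of "\<lambda>_. True"] by blast
    with * show ?thesis by (auto simp: usteps_def)
  qed
  have move: "\<exists>T. outs encoding (Seq p q) v T \<and> T \<noteq> {}" if v: "v (state_var s)" for v
  proof -
    obtain T where "outs encoding p v T" "T \<noteq> {}" using ne v by blast
    then obtain a p' where T: "outs encoding p v T" "(a, p') \<in> T" by auto
    \<comment> \<open>The target may stem from a silent dummy step and then represents no
      configuration, so its consistency comes from \<open>outs_consistent\<close>.\<close>
    have "consistent encoding (Seq p' q) (\<lambda>_. True)"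
      using outs_consistent[OF T] rep_stack_consistent[OF rep] by (simp add: consistent.intros(7))
    with T(2) have "(a, Seq p' q) \<in> lift T" by (simp add: lift_def)
    with lift[OF T(1)] T(2) show ?thesis by blast
  qed
  have "\<exists>r. usteps s (Seq p q) a r \<and> rep_config t r (pushed e x @ y' @ z)"
    if tr: "(s, a, e, x, t) \<in> pda_trans M" for a x t
  proof -
    obtain p' where p': "usteps s p a p'" "rep_config t p' (pushed e x @ y')"
      using simulates_trans[OF p[unfolded Cons] tr] by blast
    show ?thesis using fwd[OF p'] rep_config.intros(3)[OF p'(2) rep] by auto
  qed
  moreover have "\<exists>x t. (s, a, e, x, t) \<in> pda_trans M \<and> rep_config t r (pushed e x @ y' @ z)"
    if us: "usteps s (Seq p q) a r" for a r
  proof -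
    obtain p' where r: "r = Seq p' q" and p': "usteps s p a p'" using bwd[OF us] by blast
    obtain x t where "(s, a, e, x, t) \<in> pda_trans M" "rep_config t p' (pushed e x @ y')"
      using simulates_usteps[OF p[unfolded Cons] p'] by blast
    with rep_config.intros(3)[OF this(2) rep] show ?thesis by (auto simp: r)
  qed
  ultimately show ?thesis using move Cons by simp
qed

lemma rep_stack_simulates:
  assumes "s \<in> pda_states M"
  shows "rep_stack p z \<Longrightarrow> simulates s p z"
proof (induction rule: rep_stack.induct)
  case 1
  show ?case by (simp add: outs.intros)
next
  case (2 e)
  have "simulates s (Var (sym_var e)) [e] \<longleftrightarrow> simulates s (sym_body e) [e]"
    using 2 by (intro simulates_cong outs_Var_iff defn_sym_var)
  then show ?case using simulates_sym_body[OF assms] by simp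
next
  case (3 p y q z)
  show ?case
    by (rule simulates_Seq[OF 3(3,4,2)]) (simp add: rep_stack_accepts[OF 3(1)])
qed

lemma rep_config_simulates: "rep_config s p z \<Longrightarrow> simulates s p z"
proof (induction rule: rep_config.induct)
  case 1
  have "simulates (pda_initial M) (Var 0) [None] \<longleftrightarrow>
      simulates (pda_initial M) (sym_body None) [None]"
    by (rule simulates_cong) (simp add: outs_Var_iff[OF defn_root] root_body_def outs_Emit_iff)
  moreover have "pda_initial M \<in> pda_states M"
    using M by (simp add: pushdown_automaton_def)
  ultimately show ?case using simulates_sym_body by simp
next
  case (2 s p z)
  have "simulates s (Emit (signal s) p) z \<longleftrightarrow> simulates s p z"
    by (rule simulates_cong) (simp add: outs_Emit_iff)
  with 2 show ?case by (simp add: rep_stack_simulates)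
next
  case (3 s p y q z)
  show ?case
    by (rule simulates_Seq[OF 3(3) rep_stack_simulates[OF rep_config_state[OF 3(1)] 3(2)] 3(2)])
      (simp add: rep_config_accepts[OF 3(1)])
qed

section \<open>The bisimulation\<close>

lemma rep_config_accepting:
  assumes "rep_config s p z" "z \<noteq> []"
  shows "accepting (spec_graph encoding) p \<longleftrightarrow> s \<in> pda_final M"
proof
  assume "accepting (spec_graph encoding) p"
  \<comment> \<open>Acceptance is tested under the valuation in which only the signal of
    \<open>s\<close> is true; as \<open>z\<close> is nonempty, a final state must share that
    signal.\<close>
  then have "\<exists>t\<in>pda_final M. state_var t = state_var s"
    using rep_config_consistent[OF assms(1)] assms(2)
      rep_config_accepts[OF assms(1), of "\<lambda>n. n = state_var s"]
    by (simp add: spec_graph_def)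
  then show "s \<in> pda_final M"
    using rep_config_state[OF assms(1)] M state_var_eq_iff
    by (auto simp: pushdown_automaton_def)
next
  assume "s \<in> pda_final M"
  then show "accepting (spec_graph encoding) p"
    using rep_config_consistent[OF assms(1)] rep_config_accepts[OF assms(1)]
    by (auto simp: spec_graph_def)
qed

text \<open>The consistent valuations of \<open>p\<close> are exactly those satisfying the signal of
  \<open>s\<close>, over which \<open>usteps\<close> quantifies.\<close>

lemma rep_config_gtrans:
  "rep_config s p z \<Longrightarrow> gtrans (spec_graph encoding) p a q \<longleftrightarrow> usteps s p a q"
  using rep_config_consistent[of s p z] by (simp add: spec_graph_def step_def usteps_def)

text \<open>The bottom marker merges both kinds of transitions into one: remove the top
  \<open>e\<close> and put \<open>pushed e x\<close> in its place.\<close>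

lemma pda_step_iff:
  "pda_step M (s, y) a (t, y') \<longleftrightarrow>
   (\<exists>e z x. map Some y @ [None] = e # z \<and> (s, a, e, x, t) \<in> pda_trans M \<and>
      map Some y' @ [None] = pushed e x @ z)"
proof (cases y)
  case Nil
  have "map Some y' @ [None] = map Some x @ [None] \<longleftrightarrow> y' = x" for x :: "'d list"
    by (simp only: append_same_eq inj_map_eq_map[OF inj_Some])
  then show ?thesis by (simp add: Nil pda_step_Nil pushed_def)
next
  case (Cons d w)
  have "map Some y' @ [None] = map Some x @ map Some w @ [None] \<longleftrightarrow> y' = x @ w" for x
    by (simp only: append_assoc[symmetric] map_append[symmetric] append_same_eq
        inj_map_eq_map[OF inj_Some])
  then show ?thesis by (simp add: Cons pda_step_Cons pushed_def)
qed

text \<open>Moves preserve the shape of a marked stack, with the marker at the bottom and nowhere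
  else.\<close>

lemma pushed_stack:
  assumes "map Some y @ [None] = e # z"
  obtains y' where "pushed e x @ z = map Some y' @ [None]"
proof (cases y)
  case Nil
  with assms show ?thesis by (intro that[of x]) (auto simp: pushed_def)
next
  case (Cons d w)
  with assms show ?thesis by (intro that[of "x @ w"]) (auto simp: pushed_def)
qed

lemma bisimilar_encoding: "bisimilar (pda_graph M) (spec_graph encoding)"
proof -
  define R where "R = (\<lambda>(s, y) p. rep_config s p (map Some y @ [None]))"
  have "bisimulation (pda_graph M) (spec_graph encoding) R"
    unfolding bisimulation_def
  proof (intro allI impI conjI)
    fix c p
    assume "R c p"
    moreover obtain s y where c: "c = (s, y)" by (cases c)
    ultimately have rep: "rep_config s p (map Some y @ [None])" by (simp add: R_def)
    obtain e z where ez: "map Some y @ [None] = e # z"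
      by (cases "map Some y @ [None]") auto
    have sim: "simulates s p (e # z)"
      using rep_config_simulates[OF rep] ez by simp
    note gtrans = rep_config_gtrans[OF rep]
    show "accepting (pda_graph M) c \<longleftrightarrow> accepting (spec_graph encoding) p"
      using rep_config_accepting[OF rep] by (simp add: pda_graph_def c)
    show "\<exists>q. gtrans (spec_graph encoding) p a q \<and> R c' q" if "gtrans (pda_graph M) c a c'" for a c'
    proof -
      obtain t y' where c': "c' = (t, y')" by (cases c')
      from that obtain x where x: "(s, a, e, x, t) \<in> pda_trans M"
        "map Some y' @ [None] = pushed e x @ z"
        by (auto simp: pda_graph_def c c' pda_step_iff ez)
      show ?thesis using simulates_trans[OF sim x(1)] x(2) by (simp add: gtrans c' R_def)
    qed
    show "\<exists>c'. gtrans (pda_graph M) c a c' \<and> R c' q"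
      if step: "gtrans (spec_graph encoding) p a q" for a q
    proof -
      obtain x t where xt: "(s, a, e, x, t) \<in> pda_trans M" "rep_config t q (pushed e x @ z)"
        using simulates_usteps[OF sim step[unfolded gtrans]] by blast
      obtain y' where y': "pushed e x @ z = map Some y' @ [None]"
        using pushed_stack[OF ez] .
      have "pda_step M (s, y) a (t, y')"
        using xt(1) y' ez by (auto simp: pda_step_iff)
      moreover have "R (t, y') q" using xt(2) y' by (simp add: R_def)
      ultimately show ?thesis by (auto simp: pda_graph_def c)
    qed
  qed
  moreover have "R (initial (pda_graph M)) (initial (spec_graph encoding))"
    using rep_config.intros(1) by (simp add: R_def pda_graph_def spec_graph_def encoding_def)
  ultimately show ?thesis by (auto simp: bisimilar_def)
qed

end

theorem theorem8p1:
  fixes M :: "('s, 'a, 'd) pda"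
  assumes "pushdown_automaton M"
  shows "\<exists>E :: (nat, 'a, nat) spec.
           guarded_spec (pda_input M) E \<and> bisimilar (pda_graph M) (spec_graph E)"
proof -
  \<comment> \<open>Collecting only the symbols that occur in the finitely many transitions, plus
    the bottom marker, yields finitely many recursion variables.\<close>
  define syms where
    "syms = insert None (\<Union>(s, a, e, x, t)\<in>pda_trans M. insert e (Some ` set x))"
  have fin: "finite (pda_states M)" "finite (pda_trans M)" "finite (pda_final M)"
    using assms finite_subset by (auto simp: pushdown_automaton_def)
  then have syms: "finite syms" by (auto simp: syms_def)
  have trans: "e \<in> syms \<and> Some ` set x \<subseteq> syms" if "(s, a, e, x, t) \<in> pda_trans M" for s a e x t
    using that by (force simp: syms_def)
  obtain trs where "set trs = pda_trans M" using fin(2) finite_list by blast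
  moreover obtain fins where "set fins = pda_final M" using fin(3) finite_list by blast
  moreover obtain f :: "'s \<Rightarrow> nat" where "inj_on f (pda_states M)"
    using fin(1) finite_imp_inj_to_nat_seg by metis
  moreover obtain g :: "'d option \<Rightarrow> nat" where "inj_on g syms"
    using syms finite_imp_inj_to_nat_seg by metis
  ultimately interpret pda_encoding M trs fins syms f g
    using assms syms trans by unfold_locales (simp_all add: syms_def)
  show ?thesis using guarded_encoding bisimilar_encoding by blast
qed

end
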